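(* For complex $a,b,c,x,z$, $${}_2F_1(a,b;c;x+z)=\sum_{n=0}^{\infty}\sum_{j=0}^{\infty}\frac{\Gamma(c)\,x^n\,\Gamma(a+j)\,\Gamma(b+j)\,z^{j-n}}{n!\,\Gamma(a)\,\Gamma(b)\,\Gamma(c+j)\,\Gamma(j-n+1)}.$$
   Context: $\Gamma$ is the Euler gamma function, with $1/\Gamma$ equal to $0$ at nonpositive integers, and ${}_2F_1$ is the Gauss hypergeometric function.
   Formalization: Assumes c is not a nonpositive integer and either |z|<1, |x|<|1-z|, or a or b is a nonpositive integer (Gamma quotients then taken as limits), as the sums otherwise diverge or are undefined; boundary cases such as |x|=|1-z| are not claimed. *)

theory Defs
  imports "HOL-Analysis.Analysis"
begin

definition branch_cut :: "complex set" where
  "branch_cut = complex_of_real ` {1..}"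

(* Principal branch of the Gauss function: off the cut it is the analytic continuation of the
   hypergeometric series, which is unique because the complement of the cut is connected.
   On the cut the value is the sum of the series; it is meaningful when the series terminates,
   and, for Re (c - a - b) > 0, at the point 1. *)
definition hyp2F1 :: "complex \<Rightarrow> complex \<Rightarrow> complex \<Rightarrow> complex \<Rightarrow> complex" where
  "hyp2F1 a b c w =
     (if w \<in> branch_cut then eval_fps (fps_hypergeo [a, b] [c] 1) w
      else (SOME f. f holomorphic_on (- branch_cut) \<and>
                    (\<forall>u\<in>ball 0 1. f u = eval_fps (fps_hypergeo [a, b] [c] 1) u)) w)"

(* The function Gamma (w + j) / Gamma w of w has removable singularities at the nonpositive
   integers, where Gamma has poles and the library sets Gamma to 0. *)
definition Gamma_quotient :: "complex \<Rightarrow> nat \<Rightarrow> complex" where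
  "Gamma_quotient s j =
     (if s \<in> \<int>\<^sub>\<le>\<^sub>0 then Lim (at s) (\<lambda>w. Gamma (w + of_nat j) / Gamma w)
      else Gamma (s + of_nat j) / Gamma s)"

end

theory Submission
  imports Defs "HOL-Complex_Analysis.Complex_Analysis"
begin

text \<open>
  For j < n the term vanishes, and for j = k + n it is x^n (k+n choose n) F_{k+n} z^k, where F is
  the hypergeometric series; so the inner sum is x^n/n! times the n-th derivative of F at z, and the
  outer sum is the Taylor series about z of the continuation of F. If |z| < 1, the largest disc about
  z that avoids the cut has radius |1 - z|; if a or b is a nonpositive integer, F is a polynomial.

  The continuation to the slit plane is obtained by writing w = 4r/(1+r)^2 with |r| < 1. Then
  (1+r)^(-2a) F(w) is a power series in r that solves a Fuchsian equation with finite singularities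
  0, 1, -1 only. The resulting three-term recurrence shows that it converges for |r| < 1.
\<close>

lemma tendsto_shifted_quotient:
  "(\<lambda>n. (of_nat n + u) / (of_nat n + v)) \<longlonglongrightarrow> (1 :: complex)"
proof -
  have inf: "filterlim (\<lambda>n. v + of_nat n :: complex) at_infinity sequentially"
    by (rule tendsto_add_filterlim_at_infinity[OF tendsto_const tendsto_of_nat])
  have "(\<lambda>n. 1 + (u - v) / (v + of_nat n)) \<longlonglongrightarrow> 1 + 0"
    by (intro tendsto_add tendsto_const tendsto_divide_0[OF tendsto_const inf])
  moreover have "eventually (\<lambda>n. v + of_nat n \<noteq> 0) sequentially"
    by (rule filterlim_at_infinity_imp_eventually_ne[OF inf])
  hence "eventually (\<lambda>n. 1 + (u - v) / (v + of_nat n) = (of_nat n + u) / (of_nat n + v)) sequentially"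
    by eventually_elim (simp add: field_simps)
  ultimately show ?thesis
    using tendsto_cong by fastforce
qed

lemma conv_radius_ge_1_three_term_recurrence:
  fixes y \<alpha> \<beta> :: "nat \<Rightarrow> complex"
  assumes rec: "\<And>n. y (n + 2) = \<alpha> n * y (n + 1) + \<beta> n * y n"
    and \<alpha>: "\<alpha> \<longlonglongrightarrow> A" and \<beta>: "\<beta> \<longlonglongrightarrow> B" and AB: "norm A + norm B \<le> 1"
  shows "conv_radius y \<ge> 1"
proof (rule conv_radius_geI_ex')
  fix r :: real
  assume r: "0 < r" "ereal r < 1"
  define q where "q = 2 / (1 + r)"
  have q: "q > 1" "q * r < 1"
    using r by (auto simp: q_def field_simps)
  have "norm A * q + norm B \<le> (norm A + norm B) * q"
    using q by (simp add: ring_distribs mult_le_cancel_left1)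
  also have "\<dots> \<le> 1 * q"
    using q AB by (intro mult_right_mono) auto
  also have "\<dots> < q ^ 2"
    using q by (simp add: power2_eq_square)
  finally have less: "norm A * q + norm B < q ^ 2" .
  have "(\<lambda>n. norm (\<alpha> n) * q + norm (\<beta> n)) \<longlonglongrightarrow> norm A * q + norm B"
    by (intro tendsto_intros \<alpha> \<beta>)
  hence "eventually (\<lambda>n. norm (\<alpha> n) * q + norm (\<beta> n) < q ^ 2) sequentially"
    using less by (rule order_tendstoD)
  then obtain N where N: "\<And>n. n \<ge> N \<Longrightarrow> norm (\<alpha> n) * q + norm (\<beta> n) < q ^ 2"
    by (auto simp: eventually_sequentially)
  define C where "C = max (norm (y N) / q ^ N) (norm (y (N + 1)) / q ^ (N + 1))"
  have "C \<ge> 0"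
    using q by (simp add: C_def le_max_iff_disj)
  have bound: "norm (y n) \<le> C * q ^ n \<and> norm (y (n + 1)) \<le> C * q ^ (n + 1)" if "n \<ge> N" for n
    using that
  proof (induction n rule: dec_induct)
    case base
    have "norm (y N) / q ^ N \<le> C" "norm (y (N + 1)) / q ^ (N + 1) \<le> C"
      unfolding C_def by auto
    thus ?case
      using q by (simp add: pos_divide_le_eq)
  next
    case (step n)
    have "norm (y (n + 2)) \<le> norm (\<alpha> n) * norm (y (n + 1)) + norm (\<beta> n) * norm (y n)"
      unfolding rec by (metis norm_mult norm_triangle_ineq)
    also have "\<dots> \<le> norm (\<alpha> n) * (C * q ^ (n + 1)) + norm (\<beta> n) * (C * q ^ n)"
      using step.IH by (intro add_mono mult_left_mono) auto
    also have "\<dots> = (norm (\<alpha> n) * q + norm (\<beta> n)) * (C * q ^ n)"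
      by (simp add: algebra_simps)
    also have "\<dots> \<le> q ^ 2 * (C * q ^ n)"
      using N[of n] step.hyps \<open>C \<ge> 0\<close> q by (intro mult_right_mono) auto
    finally show ?case
      using step.IH by (simp add: algebra_simps power2_eq_square)
  qed
  show "summable (\<lambda>n. y n * of_real r ^ n)"
  proof (rule summable_comparison_test')
    show "summable (\<lambda>n. C * (q * r) ^ n)"
      using q r by (intro summable_mult summable_geometric) auto
    show "norm (y n * of_real r ^ n) \<le> C * (q * r) ^ n" if "n \<ge> N" for n
      using bound[OF that] r
      by (auto simp: norm_mult norm_power power_mult_distrib mult_right_mono simp flip: mult.assoc)
  qed
qed

lemma add_of_nat_nonzero: "c \<notin> \<int>\<^sub>\<le>\<^sub>0 \<Longrightarrow> c + of_nat n \<noteq> (0 :: complex)"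
  by (auto simp: add_eq_0_iff2)

lemma hypergeo_nth_Suc:
  fixes a b c :: complex
  assumes "c \<notin> \<int>\<^sub>\<le>\<^sub>0"
  shows "of_nat (Suc n) * (c + of_nat n) * fps_hypergeo [a, b] [c] 1 $ Suc n =
         (a + of_nat n) * (b + of_nat n) * fps_hypergeo [a, b] [c] 1 $ n"
proof -
  have "pochhammer c n \<noteq> 0" "c + of_nat n \<noteq> 0"
    using assms add_of_nat_nonzero[OF assms] by (auto simp: pochhammer_eq_0_iff add_eq_0_iff2)
  moreover have "of_nat (Suc n) \<noteq> (0 :: complex)" "fact n \<noteq> (0 :: complex)"
    using of_nat_neq_0 by auto
  moreover have "of_nat (fact (Suc n)) = (of_nat (Suc n) * fact n :: complex)"
    by (simp add: algebra_simps)
  ultimately show ?thesis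
    unfolding fps_hypergeo_nth foldl.simps pochhammer_Suc
    by (simp add: divide_simps del: of_nat_Suc)
qed

lemma hypergeo_ode:
  fixes a b c :: complex
  assumes "c \<notin> \<int>\<^sub>\<le>\<^sub>0"
  defines "F \<equiv> fps_hypergeo [a, b] [c] 1"
  shows "fps_X * (1 - fps_X) * fps_deriv (fps_deriv F)
          + (fps_const c - fps_const (a + b + 1) * fps_X) * fps_deriv F
          - fps_const (a * b) * F = 0"
proof (rule fps_ext)
  fix n
  show "fps_nth (fps_X * (1 - fps_X) * fps_deriv (fps_deriv F)
          + (fps_const c - fps_const (a + b + 1) * fps_X) * fps_deriv F
          - fps_const (a * b) * F) n = fps_nth 0 n"
    using hypergeo_nth_Suc[OF assms(1), of n a b, folded F_def]
    by (cases n; cases "n - 1") (auto simp: ring_distribs mult.assoc algebra_simps)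
qed

lemma quadratic_substitution_elimination:
  fixes X P a b c Y DY DDY U V DV W :: "'a::idom"
  assumes P: "P = 1 + X" "P \<noteq> 0" and W: "W * P ^ 2 = 4 * X"
    and ode: "W * (1 - W) * U + (c - (a + b + 1) * W) * V - a * b * Y = 0"
    and DY: "P ^ 3 * DY = - 2 * a * P ^ 2 * Y + 4 * (1 - X) * V"
    and DV: "P ^ 3 * DV = - 2 * a * P ^ 2 * V + 4 * (1 - X) * U"
    and DDY: "P ^ 3 * DDY + 3 * P ^ 2 * DY =
             - 2 * a * P ^ 2 * DY - 4 * a * P * Y + 4 * (1 - X) * DV - 4 * V"
  shows "X * (1 - X ^ 2) * DDY + (c + (2 * c - 4 * b) * X + (c - 4 * a - 2) * X ^ 2) * DY
           + (2 * a * (c - 2 * b) + 2 * a * (c - 2 * a - 1) * X) * Y = 0" (is "?T = 0")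
proof -
  have ode': "4 * X * (1 - X) ^ 2 * U + (c * P ^ 2 - 4 * (a + b + 1) * X) * P ^ 2 * V
                - a * b * P ^ 4 * Y = 0"
  proof -
    have "(W * P ^ 2) * (P ^ 2 - W * P ^ 2) * U + (c * P ^ 2 - (a + b + 1) * (W * P ^ 2)) * P ^ 2 * V
                - a * b * P ^ 4 * Y =
          P ^ 4 * (W * (1 - W) * U + (c - (a + b + 1) * W) * V - a * b * Y)"
      by algebra
    moreover have "P ^ 2 - 4 * X = (1 - X) ^ 2"
      using P(1) by algebra
    ultimately show ?thesis
      unfolding W ode by algebra
  qed
  have "P ^ 2 * (X * P ^ 4 * DDY + X * P ^ 3 * (3 + 2 * a) * DY + (4 * a * X - 4 * a * b) * P ^ 2 * Y
      + 4 * (X * P + 2 * a * X * (1 - X) + c * P ^ 2 - 4 * (a + b + 1) * X) * V) = 0"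
    using ode' DV DDY by algebra
  hence "X * P ^ 4 * DDY + X * P ^ 3 * (3 + 2 * a) * DY + (4 * a * X - 4 * a * b) * P ^ 2 * Y
      + 4 * (X * P + 2 * a * X * (1 - X) + c * P ^ 2 - 4 * (a + b + 1) * X) * V = 0"
    using P(2) by simp
  hence "P ^ 2 * (X * (1 - X) * P ^ 2 * DDY + X * (1 - X) * P * (3 + 2 * a) * DY
      + (1 - X) * (4 * a * X - 4 * a * b) * Y
      + (X * P + 2 * a * X * (1 - X) + c * P ^ 2 - 4 * (a + b + 1) * X) * (P * DY + 2 * a * Y)) = 0"
    using DY by algebra
  hence "X * (1 - X) * P ^ 2 * DDY + X * (1 - X) * P * (3 + 2 * a) * DY
      + (1 - X) * (4 * a * X - 4 * a * b) * Y
      + (X * P + 2 * a * X * (1 - X) + c * P ^ 2 - 4 * (a + b + 1) * X) * (P * DY + 2 * a * Y) = 0"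
    using P(2) by simp
  hence "P * ?T = 0"
    using P(1) by algebra
  thus ?thesis
    using P(2) by simp
qed

lemma conv_radius_hypergeo:
  assumes c: "c \<notin> \<int>\<^sub>\<le>\<^sub>0"
  shows "fps_conv_radius (fps_hypergeo [a, b] [c] (1 :: complex)) \<ge> 1"
proof -
  define F where "F = fps_hypergeo [a, b] [c] 1"
  define \<alpha> where "\<alpha> = (\<lambda>n. (of_nat n + (a + 1)) / (of_nat n + (c + 1)) *
                             ((of_nat n + (b + 1)) / (of_nat n + 2)))"
  have "conv_radius (fps_nth F) \<ge> 1"
  proof (rule conv_radius_ge_1_three_term_recurrence)
    show "F $ (n + 2) = \<alpha> n * F $ (n + 1) + 0 * F $ n" for n
    proof -
      have "c + of_nat (Suc n) \<noteq> 0"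
        by (rule add_of_nat_nonzero[OF c])
      hence "of_nat n + (c + 1) \<noteq> 0"
        by (simp add: add_ac)
      moreover have "of_nat n + 2 \<noteq> (0 :: complex)"
        by (metis of_nat_Suc of_nat_add of_nat_numeral of_nat_neq_0 add_2_eq_Suc')
      ultimately show ?thesis
        using hypergeo_nth_Suc[OF c, of "Suc n" a b, folded F_def]
        by (simp add: \<alpha>_def divide_simps) (simp add: algebra_simps)
    qed
    show "\<alpha> \<longlonglongrightarrow> 1 * 1"
      unfolding \<alpha>_def by (intro tendsto_mult tendsto_shifted_quotient)
  qed auto
  thus ?thesis
    by (simp add: fps_conv_radius_def F_def)
qed

text \<open>
  The substitution 4r/(1+r)^2 (a rotated and rescaled Koebe function) maps the unit disc onto the slit
  plane. It moves the singular points 1 and infinity to 1 and -1, and the factor (1+r)^(-2a) removes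
  one exponent at -1, which is what brings the recurrence for the coefficients down to three terms.
\<close>
definition hypergeo_disc :: "complex \<Rightarrow> complex \<Rightarrow> complex \<Rightarrow> complex fps" where
  "hypergeo_disc a b c =
     fps_binomial (- 2 * a) * (fps_hypergeo [a, b] [c] 1 oo (4 * fps_X * inverse ((1 + fps_X) ^ 2)))"

lemma hypergeo_disc_ode:
  fixes a b c :: complex
  assumes c: "c \<notin> \<int>\<^sub>\<le>\<^sub>0"
  defines "Y \<equiv> hypergeo_disc a b c"
  shows "fps_X * (1 - fps_X ^ 2) * fps_deriv (fps_deriv Y)
           + (fps_const c + (2 * fps_const c - 4 * fps_const b) * fps_X
                + (fps_const c - 4 * fps_const a - 2) * fps_X ^ 2) * fps_deriv Y
           + (2 * fps_const a * (fps_const c - 2 * fps_const b)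
                + 2 * fps_const a * (fps_const c - 2 * fps_const a - 1) * fps_X) * Y = 0"
proof -
  define P :: "complex fps" where "P = 1 + fps_X"
  define W where "W = 4 * fps_X * inverse (P ^ 2)"
  define F where "F = fps_hypergeo [a, b] [c] 1"
  define B where "B = fps_binomial (- 2 * a)"
  define V where "V = B * (fps_deriv F oo W)"
  define U where "U = B * (fps_deriv (fps_deriv F) oo W)"
  have Y: "Y = B * (F oo W)"
    by (simp add: Y_def hypergeo_disc_def B_def F_def W_def P_def)
  have P0: "P $ 0 \<noteq> 0" and [simp]: "P \<noteq> 0"
    by (auto simp: P_def fps_eq_iff intro: exI[of _ 0])
  have [simp]: "fps_deriv P = 1"
    by (simp add: P_def)
  have W0: "W $ 0 = 0"
    by (simp add: W_def)
  have WP: "W * P ^ 2 = 4 * fps_X"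
    using P0 by (simp add: W_def mult.assoc inverse_mult_eq_1 fps_power_zeroth)
  have W': "P ^ 3 * fps_deriv W = 4 * (1 - fps_X)"
  proof -
    have "fps_deriv W * P ^ 2 + W * (2 * P) = 4"
      using arg_cong[OF WP, of fps_deriv] by (simp add: fps_deriv_power power2_eq_square algebra_simps)
    hence "P * (fps_deriv W * P ^ 2 + W * (2 * P)) = P * 4"
      by (rule arg_cong)
    thus ?thesis
      using WP P_def by algebra
  qed
  have B': "P * fps_deriv B = - 2 * fps_const a * B"
  proof -
    have "P * fps_deriv B = (inverse P * P) * (fps_const (- 2 * a) * B)"
      using P0 unfolding B_def P_def fps_binomial_deriv
      by (subst fps_divide_unit) (simp_all add: mult_ac)
    also have "\<dots> = fps_const (- 2) * fps_const a * B"
      using P0 by (simp add: inverse_mult_eq_1)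
    finally show ?thesis
      by (simp add: numeral_fps_const fps_const_neg)
  qed
  show ?thesis
  proof (rule quadratic_substitution_elimination[where P = P and W = W and U = U and V = V
        and DV = "fps_deriv V"])
    have "(fps_X * (1 - fps_X) * fps_deriv (fps_deriv F)
          + (fps_const c - fps_const (a + b + 1) * fps_X) * fps_deriv F
          - fps_const (a * b) * F) oo W = 0 oo W"
      unfolding F_def by (subst hypergeo_ode[OF c]) auto
    hence "W * (1 - W) * (fps_deriv (fps_deriv F) oo W)
          + (fps_const c - fps_const (a + b + 1) * W) * (fps_deriv F oo W)
          - fps_const (a * b) * (F oo W) = 0"
      using W0 by (simp add: fps_compose_add_distrib fps_compose_sub_distrib fps_compose_mult_distrib
           del: fps_const_add fps_const_mult)
    hence "W * (1 - W) * (fps_deriv (fps_deriv F) oo W)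
          + (fps_const c - (fps_const a + fps_const b + 1) * W) * (fps_deriv F oo W)
          - fps_const a * fps_const b * (F oo W) = 0"
      by (simp flip: fps_const_add fps_const_mult)
    thus "W * (1 - W) * U + (fps_const c - (fps_const a + fps_const b + 1) * W) * V
             - fps_const a * fps_const b * Y = 0"
      unfolding U_def V_def Y by algebra
    show Y1: "P ^ 3 * fps_deriv Y = - 2 * fps_const a * P ^ 2 * Y + 4 * (1 - fps_X) * V"
    proof -
      have "fps_deriv Y = B * ((fps_deriv F oo W) * fps_deriv W) + fps_deriv B * (F oo W)"
        by (simp add: Y fps_compose_deriv[OF W0])
      thus ?thesis
        using B' W' unfolding V_def Y by algebra
    qed
    show "P ^ 3 * fps_deriv V = - 2 * fps_const a * P ^ 2 * V + 4 * (1 - fps_X) * U"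
    proof -
      have "fps_deriv V = B * ((fps_deriv (fps_deriv F) oo W) * fps_deriv W)
              + fps_deriv B * (fps_deriv F oo W)"
        by (simp add: V_def fps_compose_deriv[OF W0])
      thus ?thesis
        using B' W' unfolding V_def U_def by algebra
    qed
    show "P ^ 3 * fps_deriv (fps_deriv Y) + 3 * P ^ 2 * fps_deriv Y =
             - 2 * fps_const a * P ^ 2 * fps_deriv Y - 4 * fps_const a * P * Y
             + 4 * (1 - fps_X) * fps_deriv V - 4 * V"
      using arg_cong[OF Y1, of fps_deriv]
      by (simp add: fps_deriv_power power2_eq_square power3_eq_cube algebra_simps)
  qed (use WP P_def in auto)
qed

lemma hypergeo_disc_nth:
  fixes a b c :: complex and n :: nat
  assumes c: "c \<notin> \<int>\<^sub>\<le>\<^sub>0"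
  defines "y \<equiv> fps_nth (hypergeo_disc a b c)"
  shows "(of_nat n + 2) * (of_nat n + (c + 1)) * y (n + 2) =
           2 * (2 * b - c) * (of_nat n + (a + 1)) * y (n + 1)
           + (of_nat n + 2 * a) * (of_nat n + (2 * a + 1 - c)) * y n"
proof -
  define Y where "Y = hypergeo_disc a b c"
  have y: "y = fps_nth Y"
    by (simp add: y_def Y_def)
  have X: "fps_X * (1 - fps_X ^ 2) * Z = fps_X * Z - fps_X * (fps_X * (fps_X * Z))"
    "(fps_const p + q * fps_X + r * fps_X ^ 2) * Z = fps_const p * Z + fps_X * (q * Z) + fps_X * (fps_X * (r * Z))"
    "(q + r * fps_X) * Z = q * Z + fps_X * (r * Z)"
    for Z q r :: "complex fps" and p
    by (simp_all add: algebra_simps power2_eq_square)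
  have C: "2 * fps_const c - 4 * fps_const b = fps_const (2 * c - 4 * b)"
    "fps_const c - 4 * fps_const a - 2 = fps_const (c - 4 * a - 2)"
    "2 * fps_const a * (fps_const c - 2 * fps_const b) = fps_const (2 * a * (c - 2 * b))"
    "2 * fps_const a * (fps_const c - 2 * fps_const a - 1) = fps_const (2 * a * (c - 2 * a - 1))"
    by (simp_all flip: fps_const_mult fps_const_sub fps_const_1_eq_1 numeral_fps_const)
  have "fps_nth (fps_X * (1 - fps_X ^ 2) * fps_deriv (fps_deriv Y)
           + (fps_const c + (2 * fps_const c - 4 * fps_const b) * fps_X
                + (fps_const c - 4 * fps_const a - 2) * fps_X ^ 2) * fps_deriv Y
           + (2 * fps_const a * (fps_const c - 2 * fps_const b)
                + 2 * fps_const a * (fps_const c - 2 * fps_const a - 1) * fps_X) * Y) (n + 1) = 0"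
    unfolding Y_def by (subst hypergeo_disc_ode[OF c]) simp
  thus ?thesis
    unfolding C X y by (cases n; cases "n - 1") (auto simp: algebra_simps)
qed

lemma conv_radius_hypergeo_disc:
  assumes c: "c \<notin> \<int>\<^sub>\<le>\<^sub>0"
  shows "fps_conv_radius (hypergeo_disc a b c) \<ge> 1"
  unfolding fps_conv_radius_def
proof (rule conv_radius_ge_1_three_term_recurrence)
  define \<alpha> where "\<alpha> = (\<lambda>n. 2 * (2 * b - c) / (2 + of_nat n) *
                      ((of_nat n + (a + 1)) / (of_nat n + (c + 1))))"
  define \<beta> where "\<beta> = (\<lambda>n. (of_nat n + 2 * a) / (of_nat n + 2) *
                      ((of_nat n + (2 * a + 1 - c)) / (of_nat n + (c + 1))))"
  show "hypergeo_disc a b c $ (n + 2) =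
          \<alpha> n * hypergeo_disc a b c $ (n + 1) + \<beta> n * hypergeo_disc a b c $ n" for n
  proof -
    define p q where "p = of_nat n + (c + 1)" and "q = (of_nat n + 2 :: complex)"
    have "c + of_nat (Suc n) \<noteq> 0"
      by (rule add_of_nat_nonzero[OF c])
    hence "p \<noteq> 0"
      by (simp add: p_def add_ac)
    moreover have "q \<noteq> 0"
      unfolding q_def by (metis of_nat_Suc of_nat_add of_nat_numeral of_nat_neq_0 add_2_eq_Suc')
    moreover have "2 + of_nat n = q"
      by (simp add: q_def)
    ultimately show ?thesis
      using hypergeo_disc_nth[OF c, where a = a and b = b and n = n, folded p_def q_def]
      unfolding \<alpha>_def \<beta>_def p_def[symmetric] q_def[symmetric]
      by (simp add: divide_simps) (simp add: mult_ac)
  qed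
  have "filterlim (\<lambda>n. 2 + of_nat n :: complex) at_infinity sequentially"
    by (rule tendsto_add_filterlim_at_infinity[OF tendsto_const tendsto_of_nat])
  thus "\<alpha> \<longlonglongrightarrow> 0 * 1"
    unfolding \<alpha>_def by (intro tendsto_mult tendsto_shifted_quotient tendsto_divide_0[OF tendsto_const])
  show "\<beta> \<longlonglongrightarrow> 1 * 1"
    unfolding \<beta>_def by (intro tendsto_mult tendsto_shifted_quotient)
qed auto

lemma branch_cut_iff: "w \<in> branch_cut \<longleftrightarrow> Im w = 0 \<and> Re w \<ge> 1"
  by (auto simp: branch_cut_def complex_eq_iff image_iff)

lemma open_Compl_branch_cut: "open (- branch_cut)"
proof -
  have "closed {w. Im w = 0 \<and> Re w \<ge> 1}"
    by (intro closed_Collect_conj closed_Collect_eq closed_Collect_le continuous_intros)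
  moreover have "branch_cut = {w. Im w = 0 \<and> Re w \<ge> 1}"
    by (auto simp: branch_cut_iff)
  ultimately show ?thesis
    by (simp only: closed_def)
qed

lemma connected_Compl_branch_cut: "connected (- branch_cut)"
proof (rule starlike_imp_connected)
  show "starlike (- branch_cut)"
    unfolding starlike_def
  proof (intro bexI ballI subsetI)
    fix w v :: complex
    assume w: "w \<in> - branch_cut" and "v \<in> closed_segment 0 w"
    then obtain u where u: "0 \<le> u" "u \<le> 1" "v = u *\<^sub>R w"
      by (auto simp: in_segment)
    show "v \<in> - branch_cut"
    proof
      assume "v \<in> branch_cut"
      hence v: "u * Im w = 0" "u * Re w \<ge> 1"
        by (auto simp: branch_cut_iff u(3))
      hence "u \<noteq> 0"
        by auto
      hence "u > 0" "Im w = 0"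
        using u v by auto
      moreover have "Re w > 0"
        using v \<open>u > 0\<close> by (smt (verit) mult_nonneg_nonpos)
      hence "u * Re w \<le> 1 * Re w"
        using u by (intro mult_right_mono) auto
      ultimately show False
        using w v by (auto simp: branch_cut_iff)
    qed
  qed (auto simp: branch_cut_iff)
qed

lemma ball_subset_Compl_branch_cut: "ball 0 1 \<subseteq> - branch_cut"
  by (auto simp: branch_cut_def)

definition disc_of_slit_plane :: "complex \<Rightarrow> complex" where
  "disc_of_slit_plane w = (1 - csqrt (1 - w)) / (1 + csqrt (1 - w))"

lemma Re_csqrt_slit_plane:
  assumes "w \<notin> branch_cut"
  shows "Re (csqrt (1 - w)) > 0"
proof -
  define s where "s = csqrt (1 - w)"
  have s: "w = 1 - s ^ 2"
    by (simp add: s_def)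
  have "Re s \<noteq> 0"
    using assms by (auto simp: s branch_cut_iff power2_eq_square)
  thus ?thesis
    using csqrt_principal[of "1 - w"] unfolding s_def by blast
qed

lemma norm_disc_of_slit_plane:
  assumes "w \<notin> branch_cut"
  shows "norm (disc_of_slit_plane w) < 1"
proof -
  define s where "s = csqrt (1 - w)"
  have "Re s > 0"
    unfolding s_def by (rule Re_csqrt_slit_plane[OF assms])
  hence "norm (1 - s) < norm (1 + s)"
    by (simp add: cmod_def power2_eq_square algebra_simps)
  thus ?thesis
    unfolding disc_of_slit_plane_def s_def[symmetric]
    by (simp add: norm_divide divide_less_eq_1)
qed

lemma holomorphic_disc_of_slit_plane [holomorphic_intros]:
  "disc_of_slit_plane holomorphic_on - branch_cut"
proof -
  have "1 - w \<notin> \<real>\<^sub>\<le>\<^sub>0" if "w \<in> - branch_cut" for w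
    using that by (auto simp: branch_cut_iff complex_nonpos_Reals_iff)
  moreover have "1 + csqrt (1 - w) \<noteq> 0" if "w \<in> - branch_cut" for w
    using Re_csqrt_slit_plane[of w] that by (auto simp: complex_eq_iff simp del: csqrt.sel)
  ultimately show ?thesis
    unfolding disc_of_slit_plane_def by (intro holomorphic_intros) blast+
qed

lemma disc_of_slit_plane_inverse:
  assumes "w \<notin> branch_cut"
  defines "r \<equiv> disc_of_slit_plane w"
  shows "1 + r \<noteq> 0" "Re (1 + r) > 0" "4 * r * inverse ((1 + r) ^ 2) = w"
proof -
  define s where "s = csqrt (1 - w)"
  have s: "1 + s \<noteq> 0"
    using Re_csqrt_slit_plane[OF assms(1)] by (auto simp: s_def complex_eq_iff simp del: csqrt.sel)
  have "norm r < 1"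
    unfolding r_def by (rule norm_disc_of_slit_plane[OF assms(1)])
  thus "Re (1 + r) > 0"
    using abs_Re_le_cmod[of r] by simp
  thus "1 + r \<noteq> 0"
    by (auto simp: complex_eq_iff)
  have r: "r = (1 - s) / (1 + s)"
    by (simp add: r_def disc_of_slit_plane_def s_def)
  have "1 + r = 2 / (1 + s)"
    using s by (simp add: r field_simps)
  hence "inverse ((1 + r) ^ 2) = (1 + s) ^ 2 / 4"
    by (simp add: power_divide)
  hence "4 * r * inverse ((1 + r) ^ 2) = 4 * r * ((1 + s) ^ 2 / 4)"
    by (simp only:)
  also have "\<dots> = (1 - s) * (1 + s)"
    using s by (simp add: r power2_eq_square)
  also have "\<dots> = 1 - s ^ 2"
    by (simp add: power2_eq_square algebra_simps)
  finally show "4 * r * inverse ((1 + r) ^ 2) = w"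
    by (simp add: s_def)
qed

lemma hypergeo_continuation:
  fixes a b c :: complex
  assumes c: "c \<notin> \<int>\<^sub>\<le>\<^sub>0"
  defines "F \<equiv> fps_hypergeo [a, b] [c] 1"
  obtains f where "f holomorphic_on - branch_cut" "\<And>u. norm u < 1 \<Longrightarrow> f u = eval_fps F u"
proof
  define Y where "Y = hypergeo_disc a b c"
  define \<rho> where "\<rho> = disc_of_slit_plane"
  define f where "f = (\<lambda>w. (1 + \<rho> w) powr (2 * a) * eval_fps Y (\<rho> w))"
  have Y_ge: "fps_conv_radius Y \<ge> 1"
    unfolding Y_def by (rule conv_radius_hypergeo_disc[OF c])
  have "eval_fps Y holomorphic_on ball 0 1"
    by (intro holomorphic_intros) (auto simp: one_ereal_def intro!: less_le_trans[OF _ Y_ge])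
  moreover have "\<rho> ` (- branch_cut) \<subseteq> ball 0 1"
    using norm_disc_of_slit_plane by (auto simp: \<rho>_def)
  ultimately have hol: "(\<lambda>w. eval_fps Y (\<rho> w)) holomorphic_on - branch_cut"
    using holomorphic_on_compose_gen[of \<rho> "- branch_cut" "eval_fps Y" "ball 0 1"]
    by (simp add: o_def \<rho>_def holomorphic_disc_of_slit_plane)
  show holf: "f holomorphic_on - branch_cut"
    unfolding f_def
  proof (intro holomorphic_intros hol)
    show "\<rho> holomorphic_on - branch_cut"
      unfolding \<rho>_def by (rule holomorphic_disc_of_slit_plane)
    show "1 + \<rho> w \<notin> \<real>\<^sub>\<le>\<^sub>0" if "w \<in> - branch_cut" for w
      using disc_of_slit_plane_inverse(2)[of w] that by (auto simp: \<rho>_def complex_nonpos_Reals_iff)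
  qed
  have "fps_conv_radius F > 0"
    unfolding F_def by (rule less_le_trans[OF _ conv_radius_hypergeo[OF c]]) simp
  hence "(eval_fps F \<circ> (\<lambda>r. 4 * r * inverse ((1 + r) ^ 2)))
           has_fps_expansion (F oo (4 * fps_X * inverse ((1 + fps_X) ^ 2)))"
    by (intro has_fps_expansion_compose eval_fps_has_fps_expansion fps_expansion_intros) auto
  hence "(\<lambda>r. (1 + r) powr (- 2 * a) * (eval_fps F \<circ> (\<lambda>r. 4 * r * inverse ((1 + r) ^ 2))) r)
           has_fps_expansion Y"
    unfolding Y_def hypergeo_disc_def F_def[symmetric]
    by (intro has_fps_expansion_mult has_fps_expansion_binomial_complex)
  hence "eventually (\<lambda>r. eval_fps Y r =
           (1 + r) powr (- 2 * a) * eval_fps F (4 * r * inverse ((1 + r) ^ 2))) (nhds 0)"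
    by (simp add: has_fps_expansion_def)
  moreover have "filterlim \<rho> (nhds 0) (nhds 0)"
  proof -
    have "0 \<in> - branch_cut"
      by (simp add: branch_cut_iff)
    hence "isCont \<rho> 0"
      using holomorphic_on_imp_continuous_on[OF holomorphic_disc_of_slit_plane]
        continuous_on_eq_continuous_at[OF open_Compl_branch_cut]
      unfolding \<rho>_def by blast
    moreover have "\<rho> 0 = 0"
      by (simp add: \<rho>_def disc_of_slit_plane_def)
    ultimately show ?thesis
      using tendsto_at_iff_tendsto_nhds[of \<rho> 0] by (simp add: isCont_def)
  qed
  ultimately have "eventually (\<lambda>w. eval_fps Y (\<rho> w) =
           (1 + \<rho> w) powr (- 2 * a) * eval_fps F (4 * \<rho> w * inverse ((1 + \<rho> w) ^ 2))) (nhds 0)"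
    by (rule eventually_compose_filterlim)
  moreover have "eventually (\<lambda>w. w \<in> - branch_cut) (nhds 0)"
    using open_Compl_branch_cut by (intro eventually_nhds_in_open) (auto simp: branch_cut_iff)
  ultimately have "eventually (\<lambda>w. eval_fps F w = f w) (nhds 0)"
  proof eventually_elim
    case (elim w)
    hence "1 + \<rho> w \<noteq> 0" "4 * \<rho> w * inverse ((1 + \<rho> w) ^ 2) = w"
      using disc_of_slit_plane_inverse[of w] by (auto simp: \<rho>_def)
    thus ?case
      using elim by (simp add: f_def powr_minus)
  qed
  hence f: "f has_fps_expansion F"
    using \<open>fps_conv_radius F > 0\<close> by (simp add: has_fps_expansion_def)
  show "f u = eval_fps F u" if "norm u < 1" for u
    using has_fps_expansion_imp_eval_fps_eq[OF f that]
      holomorphic_on_subset[OF holf ball_subset_Compl_branch_cut] by simp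
qed

lemma hyp2F1_continuation:
  fixes a b c :: complex
  assumes c: "c \<notin> \<int>\<^sub>\<le>\<^sub>0"
  defines "F \<equiv> fps_hypergeo [a, b] [c] 1"
  obtains f where "f holomorphic_on - branch_cut" "\<And>u. norm u < 1 \<Longrightarrow> f u = eval_fps F u"
    "\<And>w. w \<notin> branch_cut \<Longrightarrow> hyp2F1 a b c w = f w"
proof -
  define Q where "Q = (\<lambda>f. f holomorphic_on (- branch_cut) \<and> (\<forall>u\<in>ball 0 1. f u = eval_fps F u))"
  have "\<exists>f. Q f"
    using hypergeo_continuation[OF c, of a b] unfolding Q_def F_def by (metis mem_ball_0)
  hence "Q (SOME f. Q f)"
    by (rule someI_ex)
  thus ?thesis
    using that[of "SOME f. Q f"] by (auto simp: Q_def hyp2F1_def F_def)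
qed

lemma nth_higher_fps_deriv:
  "((fps_deriv ^^ n) F :: 'a :: field_char_0 fps) $ k = fact (k + n) / fact k * F $ (k + n)"
proof (induction n arbitrary: k)
  case (Suc n)
  have "of_nat k + 1 \<noteq> (0 :: 'a)"
    by (metis of_nat_Suc of_nat_neq_0 add.commute)
  thus ?case
    by (simp add: Suc.IH divide_simps) (simp add: algebra_simps)
qed auto

lemma conv_radius_higher_fps_deriv:
  fixes F :: "complex fps"
  shows "fps_conv_radius ((fps_deriv ^^ n) F) \<ge> fps_conv_radius F"
  by (induction n) (auto intro: order_trans[OF _ fps_conv_radius_deriv])

lemma higher_deriv_eval_fps:
  fixes F :: "complex fps"
  assumes "norm z < fps_conv_radius F"
  shows "(deriv ^^ n) (eval_fps F) z = eval_fps ((fps_deriv ^^ n) F) z"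
  using assms
proof (induction n arbitrary: z)
  case (Suc n)
  have "eventually (\<lambda>u. u \<in> eball 0 (fps_conv_radius F)) (nhds z)"
    using Suc.prems by (intro eventually_nhds_in_open) auto
  hence "eventually (\<lambda>u. (deriv ^^ n) (eval_fps F) u = eval_fps ((fps_deriv ^^ n) F) u) (nhds z)"
    by eventually_elim (auto simp: Suc.IH)
  hence "(deriv ^^ Suc n) (eval_fps F) z = deriv (eval_fps ((fps_deriv ^^ n) F)) z"
    by (simp add: deriv_cong_ev)
  also have "\<dots> = eval_fps (fps_deriv ((fps_deriv ^^ n) F)) z"
    by (intro DERIV_imp_deriv has_field_derivative_eval_fps
          less_le_trans[OF Suc.prems conv_radius_higher_fps_deriv])
  finally show ?case
    by simp
qed auto

lemma recentred_power_series:
  fixes F :: "complex fps"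
  assumes z: "norm z < fps_conv_radius F"
    and f: "f holomorphic_on ball z r" "eventually (\<lambda>u. f u = eval_fps F u) (nhds z)"
    and x: "norm x < r"
  defines "T \<equiv> \<lambda>n k. x ^ n * of_nat ((k + n) choose n) * F $ (k + n) * z ^ k"
  shows "summable (T n)" "(\<lambda>n. \<Sum>k. T n k) sums f (x + z)"
proof -
  have T: "T n sums ((deriv ^^ n) f z / fact n * x ^ n)" for n
  proof -
    have "(\<lambda>k. (fps_deriv ^^ n) F $ k * z ^ k) sums eval_fps ((fps_deriv ^^ n) F) z"
      by (intro sums_eval_fps less_le_trans[OF z conv_radius_higher_fps_deriv])
    also have "eval_fps ((fps_deriv ^^ n) F) z = (deriv ^^ n) f z"
      using higher_deriv_eval_fps[OF z] higher_deriv_cong_ev[OF f(2)] by simp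
    finally have "(\<lambda>k. x ^ n / fact n * ((fps_deriv ^^ n) F $ k * z ^ k))
                    sums (x ^ n / fact n * (deriv ^^ n) f z)"
      by (rule sums_mult)
    moreover have "x ^ n / fact n * ((fps_deriv ^^ n) F $ k * z ^ k) = T n k" for k
      by (simp add: T_def nth_higher_fps_deriv binomial_fact field_simps)
    ultimately show ?thesis
      by (simp add: field_simps)
  qed
  show "summable (T n)"
    using T by (rule sums_summable)
  have "x + z \<in> ball z r"
    using x by (simp add: dist_norm)
  from holomorphic_power_series[OF f(1) this]
  show "(\<lambda>n. \<Sum>k. T n k) sums f (x + z)"
    using T by (simp add: sums_iff)
qed

lemma Gamma_quotient_eq_pochhammer: "Gamma_quotient s j = pochhammer s j"
proof (cases "s \<in> \<int>\<^sub>\<le>\<^sub>0")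
  case True
  have "closed (\<int>\<^sub>\<le>\<^sub>0 - {s})"
    by (rule closed_subset_Ints) (auto simp: nonpos_Ints_def)
  hence "eventually (\<lambda>w. w \<in> - (\<int>\<^sub>\<le>\<^sub>0 - {s})) (nhds s)"
    by (intro eventually_nhds_in_open open_Compl) auto
  hence "eventually (\<lambda>w. pochhammer w j = Gamma (w + of_nat j) / Gamma w) (at s)"
    unfolding eventually_at_filter by eventually_elim (auto simp: pochhammer_Gamma)
  moreover have "((\<lambda>w. pochhammer w j) \<longlongrightarrow> pochhammer s j) (at s)"
    by (simp add: pochhammer_prod) (intro tendsto_intros)
  ultimately have "((\<lambda>w. Gamma (w + of_nat j) / Gamma w) \<longlongrightarrow> pochhammer s j) (at s)"
    by (rule Lim_transform_eventually[rotated])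
  thus ?thesis
    using True by (auto simp: Gamma_quotient_def intro!: tendsto_Lim)
qed (simp add: Gamma_quotient_def pochhammer_Gamma)

lemma conv_radius_terminating_hypergeo:
  fixes a b c :: complex
  assumes "a \<in> \<int>\<^sub>\<le>\<^sub>0 \<or> b \<in> \<int>\<^sub>\<le>\<^sub>0"
  shows "fps_conv_radius (fps_hypergeo [a, b] [c] 1) = \<infinity>"
proof -
  obtain m where m: "a = - of_nat m \<or> b = - of_nat m"
    using assms by (auto elim!: nonpos_Ints_cases')
  have "conv_radius (fps_nth (fps_hypergeo [a, b] [c] 1)) \<ge> \<infinity>"
  proof (rule conv_radius_geI_ex')
    fix r :: real
    show "summable (\<lambda>n. fps_hypergeo [a, b] [c] 1 $ n * of_real r ^ n)"
    proof (rule summable_finite[of "{..m}"])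
      fix n assume "n \<notin> {..m}"
      hence "pochhammer a n = 0 \<or> pochhammer b n = 0"
        using m by (auto simp: pochhammer_of_nat_eq_0_iff)
      thus "fps_hypergeo [a, b] [c] 1 $ n * of_real r ^ n = 0"
        by auto
    qed auto
  qed
  thus ?thesis
    by (simp add: fps_conv_radius_def)
qed

lemma hyp2F1_terminating:
  fixes a b c :: complex
  assumes c: "c \<notin> \<int>\<^sub>\<le>\<^sub>0" and ab: "a \<in> \<int>\<^sub>\<le>\<^sub>0 \<or> b \<in> \<int>\<^sub>\<le>\<^sub>0"
  shows "hyp2F1 a b c w = eval_fps (fps_hypergeo [a, b] [c] 1) w"
proof (cases "w \<in> branch_cut")
  case False
  define F where "F = fps_hypergeo [a, b] [c] 1"
  obtain f where f: "f holomorphic_on - branch_cut" "\<And>u. norm u < 1 \<Longrightarrow> f u = eval_fps F u"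
    "\<And>w. w \<notin> branch_cut \<Longrightarrow> hyp2F1 a b c w = f w"
    using hyp2F1_continuation[OF c, of a b] unfolding F_def by blast
  have "eval_fps F holomorphic_on - branch_cut"
    using conv_radius_terminating_hypergeo[OF ab, of c]
    by (intro holomorphic_intros) (auto simp: F_def)
  hence "f w = eval_fps F w"
    using f(1,2) False ball_subset_Compl_branch_cut
      analytic_continuation_open[of "ball 0 1" "- branch_cut" f "eval_fps F" w]
      open_Compl_branch_cut connected_Compl_branch_cut
    by simp
  thus ?thesis
    using f(3)[OF False] by (simp add: F_def)
qed (simp add: hyp2F1_def)

lemma ball_subset_slit_plane:
  assumes "norm z < 1"
  shows "ball z (norm (1 - z)) \<subseteq> - branch_cut"
proof
  fix w assume w: "w \<in> ball z (norm (1 - z))"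
  show "w \<in> - branch_cut"
  proof
    assume "w \<in> branch_cut"
    hence w': "Im w = 0" "Re w \<ge> 1"
      by (auto simp: branch_cut_iff)
    have "Re z < 1"
      using assms complex_Re_le_cmod[of z] by simp
    hence "(1 - Re z) ^ 2 \<le> (Re w - Re z) ^ 2"
      using w' by (intro power_mono) auto
    hence "norm (1 - z) \<le> norm (w - z)"
      using w' by (simp add: cmod_def)
    thus False
      using w by (simp add: dist_norm norm_minus_commute)
  qed
qed

theorem proposition3p36:
  fixes a b c x z :: complex
    and t :: "nat \<Rightarrow> nat \<Rightarrow> complex"
  defines "t \<equiv> \<lambda>n j. Gamma c * x ^ n * Gamma_quotient a j * Gamma_quotient b j
                 * z powi (int j - int n) / fact n
                 * rGamma (c + of_nat j) * rGamma (of_nat j - of_nat n + 1)"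
  assumes c: "c \<notin> \<int>\<^sub>\<le>\<^sub>0"
    and conv: "(cmod z < 1 \<and> cmod x < cmod (1 - z)) \<or> a \<in> \<int>\<^sub>\<le>\<^sub>0 \<or> b \<in> \<int>\<^sub>\<le>\<^sub>0"
  shows "(\<forall>n. summable (t n)) \<and> (\<lambda>n. \<Sum>j. t n j) sums hyp2F1 a b c (x + z)"
proof -
  define F where "F = fps_hypergeo [a, b] [c] 1"
  define T where "T = (\<lambda>n k. x ^ n * of_nat ((k + n) choose n) * F $ (k + n) * z ^ k)"
  have T: "(\<forall>n. summable (T n)) \<and> (\<lambda>n. \<Sum>k. T n k) sums hyp2F1 a b c (x + z)"
  proof (cases "a \<in> \<int>\<^sub>\<le>\<^sub>0 \<or> b \<in> \<int>\<^sub>\<le>\<^sub>0")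
    case True
    have rad: "fps_conv_radius F = \<infinity>"
      unfolding F_def by (rule conv_radius_terminating_hypergeo[OF True])
    hence "eval_fps F holomorphic_on ball z (norm x + 1)"
      by (intro holomorphic_intros) auto
    thus ?thesis
      using recentred_power_series[of z F "eval_fps F" "norm x + 1" x] rad
      unfolding T_def hyp2F1_terminating[OF c True] F_def[symmetric] by simp
  next
    case False
    hence z: "norm z < 1" and x: "norm x < norm (1 - z)"
      using conv by auto
    obtain f where f: "f holomorphic_on - branch_cut" "\<And>u. norm u < 1 \<Longrightarrow> f u = eval_fps F u"
      "\<And>w. w \<notin> branch_cut \<Longrightarrow> hyp2F1 a b c w = f w"
      using hyp2F1_continuation[OF c, of a b] unfolding F_def by blast
    have "f holomorphic_on ball z (norm (1 - z))"
      using f(1) ball_subset_slit_plane[OF z] by (rule holomorphic_on_subset)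
    moreover have "eventually (\<lambda>u. u \<in> ball 0 1) (nhds z)"
      using z by (intro eventually_nhds_in_open) auto
    hence "eventually (\<lambda>u. f u = eval_fps F u) (nhds z)"
      by eventually_elim (auto simp: f(2))
    moreover have "norm z < fps_conv_radius F"
      using z conv_radius_hypergeo[OF c, of a b] unfolding F_def
      by (metis ereal_less(3) less_le_trans one_ereal_def)
    moreover have "x + z \<notin> branch_cut"
      using ball_subset_slit_plane[OF z] x by (force simp: dist_norm)
    ultimately show ?thesis
      using recentred_power_series[of z F f "norm (1 - z)" x] x f(3)
      unfolding T_def by simp
  qed
  have t_shift: "t n (k + n) = T n k" for n k
  proof -
    have "rGamma c = pochhammer c (k + n) * rGamma (c + of_nat (k + n))"
      by (rule pochhammer_rGamma)
    moreover have "Gamma c * rGamma c = 1"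
      using c by (simp add: rGamma_inverse_Gamma Gamma_eq_zero_iff)
    moreover have "pochhammer c (k + n) \<noteq> 0"
      using c by (auto simp: pochhammer_eq_0_iff)
    ultimately have c_quotient: "Gamma c * rGamma (c + of_nat (k + n)) = 1 / pochhammer c (k + n)"
      by (simp add: field_simps)
    have factorial: "rGamma (of_nat (k + n) - of_nat n + 1) = 1 / (fact k :: complex)"
      using Gamma_fact[of k, where ?'a = complex]
      by (simp add: rGamma_inverse_Gamma add.commute inverse_eq_divide)
    have power: "z powi (int (k + n) - int n) = z ^ k"
      by simp
    have "t n (k + n) = (Gamma c * rGamma (c + of_nat (k + n))) *
            (x ^ n * pochhammer a (k + n) * pochhammer b (k + n) * z powi (int (k + n) - int n)
             / fact n * rGamma (of_nat (k + n) - of_nat n + 1))"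
      unfolding t_def Gamma_quotient_eq_pochhammer
      by (simp only: mult_ac times_divide_eq_left times_divide_eq_right)
    also have "\<dots> = 1 / pochhammer c (k + n) *
            (x ^ n * pochhammer a (k + n) * pochhammer b (k + n) * z ^ k / fact n * (1 / fact k))"
      by (simp only: c_quotient factorial power)
    also have "\<dots> = T n k"
      by (simp add: T_def F_def binomial_fact mult_ac)
    finally show ?thesis .
  qed
  have t_less: "t n j = 0" if "j < n" for n j
  proof -
    have "of_nat j - of_nat n + 1 = - (of_nat (n - Suc j) :: complex)"
      using that by (simp add: of_nat_diff)
    hence "rGamma (of_nat j - of_nat n + 1 :: complex) = 0"
      by (simp add: rGamma_eq_zero_iff)
    thus ?thesis
      by (simp add: t_def)
  qed
  have "t n sums (\<Sum>k. T n k)" for n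
    using sums_zero_iff_shift[of n "t n" "\<Sum>k. T n k"] t_less[of _ n] T
    by (simp add: t_shift summable_sums)
  thus ?thesis
    using T by (simp add: sums_iff)
qed

end
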